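(* Let $a,b,p,q$ be integers, let $(w_n)$ be the Horadam sequence $w_0=a$, $w_1=b$, $w_n=pw_{n-1}+qw_{n-2}$ for $n\ge 2$, and let $\mathbb{O}G_n=w_ne_0+w_{n+1}e_1+\dots+w_{n+7}e_7$ be the $n$-th Horadam octonion. Put $\alpha=\frac{p+\sqrt{p^2+4q}}{2}$, $\beta=\frac{p-\sqrt{p^2+4q}}{2}$, $A=b-a\beta$, $B=b-a\alpha$, $\underline{\alpha}=1e_0+\alpha e_1+\alpha^2e_2+\dots+\alpha^7e_7$ and $\underline{\beta}=1e_0+\beta e_1+\beta^2e_2+\dots+\beta^7e_7$. Then the sum formula for Horadam octonions is $$\sum_{i=0}^n\mathbb{O}G_i=\frac{1}{\alpha-\beta}\left(\frac{B\underline{\beta}\beta^{n+1}}{1-\beta}-\frac{A\underline{\alpha}\alpha^{n+1}}{1-\alpha}\right)+K,$$ where $$K=\frac{A\underline{\alpha}(1-\beta)-B\underline{\beta}(1-\alpha)}{(\alpha-\beta)(1-\alpha)(1-\beta)}.$$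
   Context: $\mathbb{O}$ is the eight-dimensional real octonion algebra with basis $e_0=1,e_1,\dots,e_7$; addition is componentwise. The numbers $\alpha,\beta$ are the roots of the characteristic equation $t^2-pt-q=0$ of the Horadam recurrence. *)

theory Defs
  imports Complex_Main
begin

text \<open>
  Octonions with coefficients in \<open>'a\<close>, in coordinates with respect to the basis
  \<open>e\<^sub>0, \<dots>, e\<^sub>7\<close>.  The real octonion algebra is \<open>real octonion\<close>; \<open>complex octonion\<close> is its
  complexification, needed because the roots of \<open>t\<^sup>2 - p t - q\<close> are not real when
  \<open>p\<^sup>2 + 4 q < 0\<close>.
\<close>

datatype 'a octonion =
  Octonion (oct0: 'a) (oct1: 'a) (oct2: 'a) (oct3: 'a)
           (oct4: 'a) (oct5: 'a) (oct6: 'a) (oct7: 'a)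

instantiation octonion :: (ab_group_add) ab_group_add
begin

definition "0 = Octonion 0 0 0 0 0 0 0 0"

definition "x + y =
  Octonion (oct0 x + oct0 y) (oct1 x + oct1 y) (oct2 x + oct2 y) (oct3 x + oct3 y)
           (oct4 x + oct4 y) (oct5 x + oct5 y) (oct6 x + oct6 y) (oct7 x + oct7 y)"

definition "- x =
  Octonion (- oct0 x) (- oct1 x) (- oct2 x) (- oct3 x)
           (- oct4 x) (- oct5 x) (- oct6 x) (- oct7 x)"

definition "x - y =
  Octonion (oct0 x - oct0 y) (oct1 x - oct1 y) (oct2 x - oct2 y) (oct3 x - oct3 y)
           (oct4 x - oct4 y) (oct5 x - oct5 y) (oct6 x - oct6 y) (oct7 x - oct7 y)"

instance
  by standard
    (simp_all add: zero_octonion_def plus_octonion_def uminus_octonion_def minus_octonion_def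
      add.assoc add.commute)

end

definition octonion_e :: "nat \<Rightarrow> 'a::ring_1 octonion" where
  "octonion_e k =
    Octonion (of_bool (k = 0)) (of_bool (k = 1)) (of_bool (k = 2)) (of_bool (k = 3))
             (of_bool (k = 4)) (of_bool (k = 5)) (of_bool (k = 6)) (of_bool (k = 7))"

definition octonion_scale :: "'a::ring_1 \<Rightarrow> 'a octonion \<Rightarrow> 'a octonion"
    (infixr "*\<^sub>O" 75) where
  "c *\<^sub>O x = map_octonion (\<lambda>t. c * t) x"

text \<open>
  The product is given by \<open>e\<^sub>0 = 1\<close>, \<open>e\<^sub>i\<^sup>2 = -e\<^sub>0\<close> and \<open>e\<^sub>i e\<^sub>j = e\<^sub>k = -e\<^sub>j e\<^sub>i\<close> for the cyclic
  rotations of the triples \<open>(i,j,k) = 123, 145, 176, 246, 257, 347, 365\<close>.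
  It is not associative, so none of the library's ring classes can be instantiated.
\<close>

instantiation octonion :: (ring_1) "{one, times}"
begin

definition "1 = Octonion 1 0 0 0 0 0 0 0"

fun times_octonion :: "'a octonion \<Rightarrow> 'a octonion \<Rightarrow> 'a octonion" where
  "Octonion x0 x1 x2 x3 x4 x5 x6 x7 * Octonion y0 y1 y2 y3 y4 y5 y6 y7 =
    Octonion
      (x0*y0 - x1*y1 - x2*y2 - x3*y3 - x4*y4 - x5*y5 - x6*y6 - x7*y7)
      (x0*y1 + x1*y0 + (x2*y3 - x3*y2) + (x4*y5 - x5*y4) + (x7*y6 - x6*y7))
      (x0*y2 + x2*y0 + (x3*y1 - x1*y3) + (x4*y6 - x6*y4) + (x5*y7 - x7*y5))
      (x0*y3 + x3*y0 + (x1*y2 - x2*y1) + (x4*y7 - x7*y4) + (x6*y5 - x5*y6))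
      (x0*y4 + x4*y0 + (x5*y1 - x1*y5) + (x6*y2 - x2*y6) + (x7*y3 - x3*y7))
      (x0*y5 + x5*y0 + (x1*y4 - x4*y1) + (x7*y2 - x2*y7) + (x3*y6 - x6*y3))
      (x0*y6 + x6*y0 + (x1*y7 - x7*y1) + (x2*y4 - x4*y2) + (x5*y3 - x3*y5))
      (x0*y7 + x7*y0 + (x6*y1 - x1*y6) + (x2*y5 - x5*y2) + (x3*y4 - x4*y3))"

instance ..

end

lemma octonion_one_eq_e0: "1 = (octonion_e 0 :: 'a::ring_1 octonion)"
  by (simp add: one_octonion_def octonion_e_def)

lemma octonion_mult_one:
  fixes x :: "'a::ring_1 octonion"
  shows "1 * x = x" "x * 1 = x"
  by (cases x; simp add: one_octonion_def)+

lemma octonion_scale_eq_mult: "c *\<^sub>O x = (c *\<^sub>O octonion_e 0) * x"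
  by (cases x) (simp add: octonion_scale_def octonion_e_def)

lemma octonion_distrib:
  fixes x y z :: "'a::ring_1 octonion"
  shows "x * (y + z) = x * y + x * z" "(x + y) * z = x * z + y * z"
  by (cases x; cases y; cases z; simp add: plus_octonion_def algebra_simps)+

lemma octonion_alternative:
  fixes x y :: "'a::comm_ring_1 octonion"
  shows "x * (x * y) = (x * x) * y" "(y * x) * x = y * (x * x)"
  by (cases x; cases y; simp add: algebra_simps)+

lemma octonion_not_associative:
  "(octonion_e 1 * octonion_e 2) * octonion_e 4
     \<noteq> octonion_e 1 * (octonion_e 2 * octonion_e 4 :: real octonion)"
  by (simp add: octonion_e_def)

lemma octonion_basis_expansion:
  "Octonion x0 x1 x2 x3 x4 x5 x6 x7 =
    (\<Sum>k<8. [x0, x1, x2, x3, x4, x5, x6, x7] ! k *\<^sub>O octonion_e k)"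
  by (simp add: eval_nat_numeral octonion_scale_def octonion_e_def plus_octonion_def
      zero_octonion_def)

definition complexify :: "real octonion \<Rightarrow> complex octonion" where
  "complexify = map_octonion complex_of_real"

lemma complexify_mult: "complexify (x * y) = complexify x * complexify y"
  by (cases x; cases y) (simp add: complexify_def)

fun horadam :: "int \<Rightarrow> int \<Rightarrow> int \<Rightarrow> int \<Rightarrow> nat \<Rightarrow> int" where
  "horadam a b p q 0 = a"
| "horadam a b p q (Suc 0) = b"
| "horadam a b p q (Suc (Suc n)) = p * horadam a b p q (Suc n) + q * horadam a b p q n"

definition horadam_octonion :: "int \<Rightarrow> int \<Rightarrow> int \<Rightarrow> int \<Rightarrow> nat \<Rightarrow> real octonion" where
  "horadam_octonion a b p q n =
    (\<Sum>k<8. of_int (horadam a b p q (n + k)) *\<^sub>O octonion_e k)"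

text \<open>The octonions written \<open>\<alpha>\<close> and \<open>\<beta>\<close> with an underline.\<close>

definition power_octonion :: "'a::ring_1 \<Rightarrow> 'a octonion" where
  "power_octonion t = (\<Sum>k<8. t ^ k *\<^sub>O octonion_e k)"

end

theory Submission
  imports Defs
begin

text \<open>
  Binet's formula \<open>(\<alpha> - \<beta>) w\<^sub>n = A \<alpha>\<^sup>n - B \<beta>\<^sup>n\<close>, applied in each coordinate, writes the \<open>n\<close>-th
  Horadam octonion as a combination of the two fixed octonions \<open>\<alpha>\<close> and \<open>\<beta>\<close> (underlined in the
  paper) with geometric coefficients.  Summing the two geometric series gives the formula.
  The argument works over any field containing two distinct roots of \<open>t\<^sup>2 - p t - q\<close>, so the real
  and the complex case are instances of the same result.
\<close>

interpretation octonion: module "octonion_scale :: 'a::comm_ring_1 \<Rightarrow> 'a octonion \<Rightarrow> 'a octonion"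
proof
  fix c d :: 'a and x y :: "'a octonion"
  show "c *\<^sub>O (x + y) = c *\<^sub>O x + c *\<^sub>O y"
    by (cases x; cases y) (simp add: octonion_scale_def plus_octonion_def algebra_simps)
  show "(c + d) *\<^sub>O x = c *\<^sub>O x + d *\<^sub>O x"
    by (cases x) (simp add: octonion_scale_def plus_octonion_def algebra_simps)
  show "c *\<^sub>O d *\<^sub>O x = (c * d) *\<^sub>O x"
    by (cases x) (simp add: octonion_scale_def algebra_simps)
  show "1 *\<^sub>O x = x"
    by (cases x) (simp add: octonion_scale_def)
qed

lemma complexify_add: "complexify (x + y) = complexify x + complexify y"
  by (cases x; cases y) (simp add: complexify_def plus_octonion_def)

lemma complexify_zero: "complexify 0 = 0"
  by (simp add: complexify_def zero_octonion_def)

lemma complexify_sum: "complexify (sum f S) = (\<Sum>i\<in>S. complexify (f i))"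
  by (induction S rule: infinite_finite_induct) (simp_all add: complexify_add complexify_zero)

lemma complexify_scale: "complexify (c *\<^sub>O x) = complex_of_real c *\<^sub>O complexify x"
  by (cases x) (simp add: complexify_def octonion_scale_def)

lemma complexify_e: "complexify (octonion_e k) = octonion_e k"
  by (simp add: complexify_def octonion_e_def)

text \<open>Both sides obey the Horadam recurrence in \<open>n\<close> and agree at 0 and 1, where
  the right side is \<open>a * (\<alpha> - \<beta>)\<close> and
  \<open>b * (\<alpha> - \<beta>)\<close>. Keeping the factor \<open>\<alpha> - \<beta>\<close> on
  the left makes the induction free of division.\<close>

lemma horadam_binet:
  fixes \<alpha> \<beta> :: "'a::comm_ring_1"
  assumes "\<alpha>\<^sup>2 = of_int p * \<alpha> + of_int q" "\<beta>\<^sup>2 = of_int p * \<beta> + of_int q"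
  shows "(\<alpha> - \<beta>) * of_int (horadam a b p q n) =
    (of_int b - of_int a * \<beta>) * \<alpha> ^ n - (of_int b - of_int a * \<alpha>) * \<beta> ^ n"
proof (induction n rule: induct_nat_012)
  case (ge2 n)
  have "t ^ Suc (Suc n) = of_int p * t ^ Suc n + of_int q * t ^ n"
    if "t\<^sup>2 = of_int p * t + of_int q" for t :: 'a
  proof -
    have "t ^ Suc (Suc n) = t\<^sup>2 * t ^ n"
      by (simp add: power2_eq_square mult.assoc)
    then show ?thesis
      by (simp add: that algebra_simps)
  qed
  note powers = this[OF assms(1)] this[OF assms(2)]
  have "(\<alpha> - \<beta>) * of_int (horadam a b p q (Suc (Suc n))) =
    of_int p * ((\<alpha> - \<beta>) * of_int (horadam a b p q (Suc n))) +
    of_int q * ((\<alpha> - \<beta>) * of_int (horadam a b p q n))"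
    by (simp add: algebra_simps)
  \<comment> \<open>After the rewriting this is a polynomial identity with the powers as atoms;
    \<open>simp only\<close> keeps \<open>\<alpha> ^ Suc n\<close> from being expanded.\<close>
  then show ?case
    unfolding ge2.IH powers by (simp only: algebra_simps)
qed (simp_all add: algebra_simps)

text \<open>Splitting \<open>\<alpha> ^ (n + k)\<close> into
  \<open>\<alpha> ^ n * \<alpha> ^ k\<close> leaves a scalar depending on \<open>n\<close> only and
  gathers the dependence on \<open>k\<close> into \<open>power_octonion\<close>. The left side is
  written out because \<open>horadam_octonion\<close> has real coefficients, while the field here is
  arbitrary.\<close>

lemma horadam_octonion_binet:
  fixes \<alpha> \<beta> :: "'a::field" and a b :: int
  assumes "\<alpha>\<^sup>2 = of_int p * \<alpha> + of_int q" "\<beta>\<^sup>2 = of_int p * \<beta> + of_int q" "\<alpha> \<noteq> \<beta>"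
  defines "A \<equiv> of_int b - of_int a * \<beta>" and "B \<equiv> of_int b - of_int a * \<alpha>"
  shows "(\<Sum>k<8. of_int (horadam a b p q (n + k)) *\<^sub>O octonion_e k) =
    (A * \<alpha> ^ n / (\<alpha> - \<beta>)) *\<^sub>O power_octonion \<alpha> - (B * \<beta> ^ n / (\<alpha> - \<beta>)) *\<^sub>O power_octonion \<beta>"
proof -
  have "of_int (horadam a b p q (n + k)) =
    A * \<alpha> ^ n / (\<alpha> - \<beta>) * \<alpha> ^ k - B * \<beta> ^ n / (\<alpha> - \<beta>) * \<beta> ^ k" for k
  proof -
    have "of_int (horadam a b p q (n + k)) = (A * \<alpha> ^ (n + k) - B * \<beta> ^ (n + k)) / (\<alpha> - \<beta>)"
      using horadam_binet[OF assms(1,2), of a b "n + k"] assms(3)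
      by (simp add: A_def B_def eq_divide_eq mult.commute)
    then show ?thesis
      by (simp add: diff_divide_distrib power_add mult.assoc)
  qed
  then show ?thesis
    by (simp add: power_octonion_def octonion.scale_sum_right octonion.scale_left_diff_distrib
        sum_subtractf)
qed

lemma horadam_octonion_sum:
  fixes \<alpha> \<beta> :: "'a::field" and a b :: int
  assumes "\<alpha>\<^sup>2 = of_int p * \<alpha> + of_int q" "\<beta>\<^sup>2 = of_int p * \<beta> + of_int q"
    and "\<alpha> \<noteq> \<beta>" "\<alpha> \<noteq> 1" "\<beta> \<noteq> 1"
  defines "A \<equiv> of_int b - of_int a * \<beta>" and "B \<equiv> of_int b - of_int a * \<alpha>"
  shows "(\<Sum>i=0..n. \<Sum>k<8. of_int (horadam a b p q (i + k)) *\<^sub>O octonion_e k) =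
    (1 / (\<alpha> - \<beta>)) *\<^sub>O
      ((B * \<beta> ^ (n + 1) / (1 - \<beta>)) *\<^sub>O power_octonion \<beta>
       - (A * \<alpha> ^ (n + 1) / (1 - \<alpha>)) *\<^sub>O power_octonion \<alpha>)
    + (1 / ((\<alpha> - \<beta>) * (1 - \<alpha>) * (1 - \<beta>))) *\<^sub>O
      ((A * (1 - \<beta>)) *\<^sub>O power_octonion \<alpha> - (B * (1 - \<alpha>)) *\<^sub>O power_octonion \<beta>)"
    (is "?S = ?R")
proof -
  \<comment> \<open>The closed form is split in two: the constant term goes into K, the term with
    \<open>t ^ (n + 1)\<close> into the other bracket.\<close>
  have geometric: "(\<Sum>i=0..n. C * t ^ i / d) = C / (d * (1 - t)) - C * t ^ (n + 1) / (d * (1 - t))"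
    if "t \<noteq> 1" for C d t :: 'a
  proof -
    have "(\<Sum>i=0..n. C * t ^ i / d) = C / d * (\<Sum>i\<le>n. t ^ i)"
      by (simp add: sum_distrib_left atLeast0AtMost)
    also have "(\<Sum>i\<le>n. t ^ i) = (1 - t ^ (n + 1)) / (1 - t)"
      using that sum_gp_basic[of t n] by (simp add: eq_divide_eq mult.commute)
    finally show ?thesis
      by (simp add: diff_divide_distrib right_diff_distrib)
  qed
  \<comment> \<open>Each half of K loses the factor belonging to the other root and so becomes the
    constant term of one geometric sum.\<close>
  have cancel: "1 / ((\<alpha> - \<beta>) * (1 - \<alpha>) * (1 - \<beta>)) * (A * (1 - \<beta>)) = A / ((\<alpha> - \<beta>) * (1 - \<alpha>))"
    "1 / ((\<alpha> - \<beta>) * (1 - \<alpha>) * (1 - \<beta>)) * (B * (1 - \<alpha>)) = B / ((\<alpha> - \<beta>) * (1 - \<beta>))"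
    using assms(4,5) by simp_all
  have "?S = (\<Sum>i=0..n. A * \<alpha> ^ i / (\<alpha> - \<beta>)) *\<^sub>O power_octonion \<alpha>
      - (\<Sum>i=0..n. B * \<beta> ^ i / (\<alpha> - \<beta>)) *\<^sub>O power_octonion \<beta>"
    unfolding horadam_octonion_binet[OF assms(1-3)] A_def B_def
    by (simp add: sum_subtractf octonion.scale_sum_left)
  also have "\<dots> = ?R"
    unfolding geometric[OF assms(4)] geometric[OF assms(5)]
      octonion.scale_right_diff_distrib octonion.scale_scale cancel octonion.scale_left_diff_distrib
    by simp
  finally show ?thesis .
qed

text \<open>Stated for any square root \<open>s\<close> of the discriminant, so that it fits both
  \<open>sqrt\<close> and \<open>csqrt\<close>.\<close>

lemma quadratic_roots:
  fixes p q s :: "'a::field_char_0"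
  assumes "s\<^sup>2 = p\<^sup>2 + 4 * q"
  shows "((p + s) / 2)\<^sup>2 = p * ((p + s) / 2) + q" "((p - s) / 2)\<^sup>2 = p * ((p - s) / 2) + q"
  using assms by (simp_all add: field_simps power2_eq_square)

text \<open>The coordinates are integers, so complexification only changes the target of
  \<open>of_int\<close>, and the sum formula over a general field applies.\<close>

lemma complexify_horadam_octonion:
  "complexify (horadam_octonion a b p q n) =
    (\<Sum>k<8. of_int (horadam a b p q (n + k)) *\<^sub>O octonion_e k)"
  by (simp add: horadam_octonion_def complexify_sum complexify_scale complexify_e)

theorem theorem3p4:
  fixes a b p q :: int and n :: nat
  shows
    "(p\<^sup>2 + 4 * q > 0 \<longrightarrow>
      (let \<alpha> = (of_int p + sqrt (of_int (p\<^sup>2 + 4 * q))) / 2;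
           \<beta> = (of_int p - sqrt (of_int (p\<^sup>2 + 4 * q))) / 2;
           A = of_int b - of_int a * \<beta>;
           B = of_int b - of_int a * \<alpha>;
           K = (1 / ((\<alpha> - \<beta>) * (1 - \<alpha>) * (1 - \<beta>))) *\<^sub>O
                 ((A * (1 - \<beta>)) *\<^sub>O power_octonion \<alpha> - (B * (1 - \<alpha>)) *\<^sub>O power_octonion \<beta>)
       in \<alpha> \<noteq> 1 \<longrightarrow> \<beta> \<noteq> 1 \<longrightarrow>
         (\<Sum>i=0..n. horadam_octonion a b p q i) =
           (1 / (\<alpha> - \<beta>)) *\<^sub>O
             ((B * \<beta> ^ (n + 1) / (1 - \<beta>)) *\<^sub>O power_octonion \<beta>
              - (A * \<alpha> ^ (n + 1) / (1 - \<alpha>)) *\<^sub>O power_octonion \<alpha>) + K))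
     \<and>
     (p\<^sup>2 + 4 * q \<noteq> 0 \<longrightarrow>
      (let \<alpha> = (of_int p + csqrt (of_int (p\<^sup>2 + 4 * q))) / 2;
           \<beta> = (of_int p - csqrt (of_int (p\<^sup>2 + 4 * q))) / 2;
           A = of_int b - of_int a * \<beta>;
           B = of_int b - of_int a * \<alpha>;
           K = (1 / ((\<alpha> - \<beta>) * (1 - \<alpha>) * (1 - \<beta>))) *\<^sub>O
                 ((A * (1 - \<beta>)) *\<^sub>O power_octonion \<alpha> - (B * (1 - \<alpha>)) *\<^sub>O power_octonion \<beta>)
       in \<alpha> \<noteq> 1 \<longrightarrow> \<beta> \<noteq> 1 \<longrightarrow>
         complexify (\<Sum>i=0..n. horadam_octonion a b p q i) =
           (1 / (\<alpha> - \<beta>)) *\<^sub>O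
             ((B * \<beta> ^ (n + 1) / (1 - \<beta>)) *\<^sub>O power_octonion \<beta>
              - (A * \<alpha> ^ (n + 1) / (1 - \<alpha>)) *\<^sub>O power_octonion \<alpha>) + K))"
  unfolding Let_def
proof (intro conjI impI, goal_cases)
  case 1
  let ?s = "sqrt (of_int (p\<^sup>2 + 4 * q))"
  let ?\<alpha> = "(of_int p + ?s) / 2" and ?\<beta> = "(of_int p - ?s) / 2"
  \<comment> \<open>Positivity serves twice: the root is nonzero, and it squares back to the
    discriminant, which fails for real \<open>sqrt\<close> at negative arguments.\<close>
  have "0 < real_of_int (p\<^sup>2 + 4 * q)"
    using 1(1) by (simp only: of_int_0_less_iff)
  then have "?s \<noteq> 0" and square: "?s\<^sup>2 = (of_int p)\<^sup>2 + 4 * of_int q"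
    by simp_all
  have "?\<alpha> \<noteq> ?\<beta>"
    using \<open>?s \<noteq> 0\<close> by (simp add: field_simps)
  show ?case
    unfolding horadam_octonion_def
    by (rule horadam_octonion_sum[OF quadratic_roots[OF square] \<open>?\<alpha> \<noteq> ?\<beta>\<close> 1(2,3)])
next
  case 2
  let ?s = "csqrt (of_int (p\<^sup>2 + 4 * q))"
  let ?\<alpha> = "(of_int p + ?s) / 2" and ?\<beta> = "(of_int p - ?s) / 2"
  have "?s \<noteq> 0"
    using 2(1) by (simp only: csqrt_eq_0 of_int_eq_0_iff not_False_eq_True)
  \<comment> \<open>Unlike \<open>sqrt\<close>, \<open>csqrt\<close> squares back to every argument,
    so negative discriminants are covered.\<close>
  have square: "?s\<^sup>2 = (of_int p)\<^sup>2 + 4 * of_int q"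
    by simp
  \<comment> \<open>The two roots differ by exactly \<open>?s\<close>.\<close>
  have "?\<alpha> \<noteq> ?\<beta>"
    using \<open>?s \<noteq> 0\<close> by (simp add: field_simps)
  show ?case
    unfolding complexify_sum complexify_horadam_octonion
    by (rule horadam_octonion_sum[OF quadratic_roots[OF square] \<open>?\<alpha> \<noteq> ?\<beta>\<close> 2(2,3)])
qed

end
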